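(* Let $R\in\mathbb R^{n\times m}$ have independent entries $R_{ij}\sim N(0,g/n)$, independent of the collection $v_s:=\psi_1(s)$, $s\in T$, where $T$ is finite and nonempty. Assume $L_s$, $s\in T$, are nonnegative upper bounds for the post-layer Lipschitz constants, deterministic or measurable with respect to variables independent of $R$. Define the nominal rectangular Marchenko--Pastur singular-value edge of $R$ by $$\sigma_{+,R}:=\sqrt g\left(1+\sqrt{\frac mn}\right).$$ Then for every $\delta\in(0,1)$, with probability at least $1-\delta$, $$B_T(R)\le\frac{2\sigma_{+,R}}{1+\sqrt{m/n}}\,\sqrt{\frac2n\log\frac{2n|T|}{\delta}}\;\frac1{|T|}\sum_{s\in T}L_s\|v_s\|_2.$$
   Context: A target layer $A=S+R\in\mathbb R^{n\times m}$ sits inside a network with logits $\psi_2(A\psi_1(s))\in\mathbb R^K$, $s\in T$, where $\psi_1$ (values in $\mathbb R^m$) and $\psi_2:\mathbb R^n\to\mathbb R^K$ are the pre- and post-layer maps with other parameters frozen. $L_s$ bounds the $\ell_\infty$-Lipschitz constant of $\psi_2$ on the path $\{(S+\theta R)\psi_1(s):0\le\theta\le1\}$. The data-path budget is $B_T(R):=\frac2{|T|}\sum_{s\in T}L_s\|R\psi_1(s)\|_\infty$, with $\|\cdot\|_\infty$ the vector maximum norm and $\|\cdot\|_2$ the Euclidean norm; $g\ge0$. *)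

theory Defs
  imports "HOL-Probability.Probability"
begin

(* The variance is allowed to be 0, where N(mu, 0) is the point mass at mu;
   normal_density takes the standard deviation as its second argument. *)
definition gaussian_measure :: "real \<Rightarrow> real \<Rightarrow> real measure" where
  "gaussian_measure \<mu> v =
     (if v = 0 then return borel \<mu> else density lborel (normal_density \<mu> (sqrt v)))"

definition has_gaussian_law :: "'w measure \<Rightarrow> ('w \<Rightarrow> real) \<Rightarrow> real \<Rightarrow> real \<Rightarrow> bool" where
  "has_gaussian_law M X \<mu> v \<longleftrightarrow>
     X \<in> borel_measurable M \<and> distr M borel X = gaussian_measure \<mu> v"

(* The library constant indep_var requires both variables to have the same value type. *)
definition indep_rv ::
  "'w measure \<Rightarrow> 'a measure \<Rightarrow> ('w \<Rightarrow> 'a) \<Rightarrow> 'b measure \<Rightarrow> ('w \<Rightarrow> 'b) \<Rightarrow> bool" where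
  "indep_rv M N X P Y \<longleftrightarrow>
     X \<in> measurable M N \<and> Y \<in> measurable M P \<and>
     prob_space.indep_set M (sets (vimage_algebra (space M) X N))
                            (sets (vimage_algebra (space M) Y P))"

definition linf_lipschitz_on ::
  "real \<Rightarrow> ('a::euclidean_space) set \<Rightarrow> ('a \<Rightarrow> 'b::euclidean_space) \<Rightarrow> bool" where
  "linf_lipschitz_on L U f \<longleftrightarrow>
     (\<forall>x\<in>U. \<forall>y\<in>U. infnorm (f x - f y) \<le> L * infnorm (x - y))"

definition layer_path ::
  "real ^ 'm ^ 'n \<Rightarrow> real ^ 'm ^ 'n \<Rightarrow> real ^ 'm \<Rightarrow> (real ^ 'n) set" where
  "layer_path S R x = {(S + \<theta> *\<^sub>R R) *v x | \<theta>. 0 \<le> \<theta> \<and> \<theta> \<le> 1}"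

definition data_path_budget ::
  "'s set \<Rightarrow> ('s \<Rightarrow> real) \<Rightarrow> ('s \<Rightarrow> real ^ 'm) \<Rightarrow> real ^ 'm ^ 'n \<Rightarrow> real" where
  "data_path_budget T L \<psi>\<^sub>1 R =
     2 / real (card T) * (\<Sum>s\<in>T. L s * infnorm (R *v \<psi>\<^sub>1 s))"

(* Nominal Marchenko--Pastur singular-value edge of an n x m matrix with entry variance g/n. *)
definition mp_edge :: "real \<Rightarrow> nat \<Rightarrow> nat \<Rightarrow> real" where
  "mp_edge g n m = sqrt g * (1 + sqrt (real m / real n))"

end

theory Submission
  imports Defs
begin

text \<open>
  Since \<open>mp_edge g n m / (1 + sqrt (m / n)) = sqrt g\<close>, it suffices that with probability at least
  \<open>1 - \<delta>\<close> all coordinates satisfy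
  \<open>\<bar>(R v\<^sub>s)\<^sub>i\<bar> \<le> sqrt g * c * norm v\<^sub>s\<close> with \<open>c\<^sup>2 = 2 / n * ln (2 n |T| / \<delta>)\<close>. For a fixed vector
  \<open>x\<close> the coordinate \<open>(R x)\<^sub>i\<close> is centred Gaussian of variance \<open>g / n * (norm x)\<^sup>2\<close>, so Chernoff's
  bound gives failure probability at most \<open>2 * exp (- n c\<^sup>2 / 2)\<close>; Fubini transfers this to the
  independent random \<open>v\<^sub>s\<close>, and a union bound over \<open>n |T|\<close> pairs \<open>(i, s)\<close> gives \<open>\<delta>\<close>.
\<close>

section \<open>Moment generating function and tails of a centred Gaussian\<close>

lemma gaussian_mgf:
  assumes "prob_space M" "has_gaussian_law M X 0 v" "v \<ge> 0"
  shows "integrable M (\<lambda>\<omega>. exp (l * X \<omega>))"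
    and "integral\<^sup>L M (\<lambda>\<omega>. exp (l * X \<omega>)) = exp (l\<^sup>2 * v / 2)"
proof -
  interpret prob_space M by fact
  have X[measurable]: "X \<in> borel_measurable M" and D: "distr M borel X = gaussian_measure 0 v"
    using assms(2) by (auto simp: has_gaussian_law_def)
  have "has_bochner_integral (gaussian_measure 0 v) (\<lambda>x. exp (l * x)) (exp (l\<^sup>2 * v / 2))"
  proof (cases "v = 0")
    case True
    \<comment> \<open>With variance zero the law is the point mass at 0, so the integral is the
      value of the integrand there, which is 1 and agrees with
      \<open>exp (l\<^sup>2 * v / 2)\<close>.\<close>
    have "has_bochner_integral (return borel (0::real)) (\<lambda>x. exp (l * x)) (exp (l * 0))"
    proof -
      interpret r: prob_space "return borel (0::real)" by (rule prob_space_return) simp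
      have ae: "AE x in return borel (0::real). exp (l * x) = exp (l * 0)"
        by (subst AE_return) auto
      have "has_bochner_integral (return borel (0::real)) (\<lambda>x. exp (l * 0)) (exp (l * 0))"
        using r.prob_space by (simp add: has_bochner_integral_iff)
      with ae show ?thesis
        by (subst has_bochner_integral_cong_AE[where g = "\<lambda>_. exp (l * 0)"]) auto
    qed
    then show ?thesis using True by (simp add: gaussian_measure_def)
  next
    case False
    then have v: "v > 0" using assms by simp
    \<comment> \<open>Completing the square: exponential tilting of N(0, v) shifts the mean to
      \<open>l * v\<close> and leaves the variance alone. The shifted density integrates to 1, so
      only the prefactor survives.\<close>
    have eq: "normal_density 0 (sqrt v) x * exp (l * x)
        = exp (l\<^sup>2 * v / 2) * normal_density (l * v) (sqrt v) x" for x
      using v by (simp add: normal_density_def exp_add[symmetric] field_simps power2_eq_square)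
    have "has_bochner_integral lborel (\<lambda>x. exp (l\<^sup>2 * v / 2) * normal_density (l * v) (sqrt v) x)
        (exp (l\<^sup>2 * v / 2) * 1)"
      using v by (intro has_bochner_integral_mult_right)
        (auto simp: has_bochner_integral_iff)
    then have "has_bochner_integral lborel (\<lambda>x. normal_density 0 (sqrt v) x *\<^sub>R exp (l * x))
        (exp (l\<^sup>2 * v / 2))"
      by (simp add: eq)
    then show ?thesis
      unfolding gaussian_measure_def using False v
      by (simp add: has_bochner_integral_density)
  qed
  then have "has_bochner_integral M (\<lambda>\<omega>. exp (l * X \<omega>)) (exp (l\<^sup>2 * v / 2))"
    by (simp add: D[symmetric] has_bochner_integral_iff integrable_distr_eq integral_distr)
  then show "integrable M (\<lambda>\<omega>. exp (l * X \<omega>))"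
    and "integral\<^sup>L M (\<lambda>\<omega>. exp (l * X \<omega>)) = exp (l\<^sup>2 * v / 2)"
    by (auto simp: has_bochner_integral_iff)
qed

text \<open>Chernoff's bound at the parameter \<open>t / v\<close>, the minimiser of
  \<open>l\<^sup>2 * v / 2 - l * t\<close>, applied to X and to -X; the factor 2 pays for the two
  signs.\<close>

lemma (in prob_space) subgaussian_tail:
  assumes [measurable]: "X \<in> borel_measurable M"
    and "\<And>l. integrable M (\<lambda>\<omega>. exp (l * X \<omega>))"
    and "\<And>l. expectation (\<lambda>\<omega>. exp (l * X \<omega>)) \<le> exp (l\<^sup>2 * v / 2)"
    and "v > 0" "t > 0"
  shows "prob {\<omega> \<in> space M. \<bar>X \<omega>\<bar> > t} \<le> 2 * exp (- t\<^sup>2 / (2 * v))"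
proof -
  \<comment> \<open>The condition \<open>a\<^sup>2 = 1\<close> stands for a sign, so that one
    argument covers both tails.\<close>
  have one_sided: "prob {\<omega> \<in> space M. a * X \<omega> \<ge> t} \<le> exp (- t\<^sup>2 / (2 * v))" if a: "a\<^sup>2 = 1" for a
  proof -
    have int: "integrable M (\<lambda>\<omega>. exp ((t / v) * (a * X \<omega>)))"
      using assms(2)[of "t / v * a"] by (simp add: mult.assoc)
    have set_int: "set_integrable M (space M) (\<lambda>\<omega>. exp ((t / v) * (a * X \<omega>)))"
      unfolding set_integrable_def by (rule integrable_mult_indicator[OF sets.top int])
    have "prob {\<omega> \<in> space M. a * X \<omega> \<ge> t}
        \<le> exp (- (t / v) * t) * expectation (\<lambda>\<omega>. exp ((t / v) * (a * X \<omega>)))"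
      unfolding set_integral_space[OF int, symmetric] using assms(4,5)
      by (intro Chernoff_ineq_ge set_int) auto
    also have "\<dots> \<le> exp (- (t / v) * t) * exp ((t / v * a)\<^sup>2 * v / 2)"
      using assms(3)[of "t / v * a"] by (simp add: mult_ac)
    also have "(t / v * a)\<^sup>2 * v / 2 = t\<^sup>2 / (2 * v)"
      using a assms(4) by (simp add: power_mult_distrib) (simp add: power2_eq_square field_simps)
    also have "exp (- (t / v) * t) * exp (t\<^sup>2 / (2 * v)) = exp (- t\<^sup>2 / (2 * v))"
      unfolding exp_add[symmetric] using assms(4) by (simp add: power2_eq_square field_simps)
    finally show ?thesis .
  qed
  have "prob {\<omega> \<in> space M. \<bar>X \<omega>\<bar> > t}
      \<le> prob ({\<omega> \<in> space M. 1 * X \<omega> \<ge> t} \<union> {\<omega> \<in> space M. (-1) * X \<omega> \<ge> t})"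
    by (intro finite_measure_mono) auto
  also have "\<dots> \<le> prob {\<omega> \<in> space M. 1 * X \<omega> \<ge> t} + prob {\<omega> \<in> space M. (-1) * X \<omega> \<ge> t}"
    by (intro measure_Un_le) measurable
  also have "\<dots> \<le> 2 * exp (- t\<^sup>2 / (2 * v))"
    using one_sided[of 1] one_sided[of "-1"] by simp
  finally show ?thesis .
qed

section \<open>Linear combinations of independent Gaussians\<close>

lemma (in prob_space) indep_vars_reindex:
  assumes ind: "indep_vars N X (f ` I)" and inj: "inj_on f I"
  shows "indep_vars (\<lambda>i. N (f i)) (\<lambda>i. X (f i)) I"
proof -
  let ?F = "\<lambda>i. {X i -` A \<inter> space M | A. A \<in> sets (N i)}"
  have F: "indep_sets ?F (f ` I)" using ind by (simp add: indep_vars_def2)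
  have "indep_sets (\<lambda>i. ?F (f i)) I"
  proof (rule indep_setsI)
    show "?F (f i) \<subseteq> events" if "i \<in> I" for i
      using F that by (auto simp: indep_sets_def)
    fix A J assume J: "J \<noteq> {}" "J \<subseteq> I" "finite J" and A: "\<forall>j\<in>J. A j \<in> ?F (f j)"
    have injJ: "inj_on f J" using inj J(2) by (rule inj_on_subset)
    let ?B = "A \<circ> the_inv_into J f"
    have B: "?B (f j) = A j" if "j \<in> J" for j
      using the_inv_into_f_f[OF injJ that] by simp
    have "prob (\<Inter>k\<in>f ` J. ?B k) = (\<Prod>k\<in>f ` J. prob (?B k))"
    proof (rule indep_setsD[OF F])
      show "\<forall>k\<in>f ` J. ?B k \<in> ?F k"
      proof
        fix k assume "k \<in> f ` J"
        then obtain j where j: "j \<in> J" "k = f j" by auto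
        show "?B k \<in> ?F k" unfolding j(2) B[OF j(1)] using A j(1) by (rule bspec)
      qed
    qed (use J in auto)
    moreover have "(\<Inter>k\<in>f ` J. ?B k) = (\<Inter>j\<in>J. A j)"
      by (subst image_image) (intro INF_cong refl B)
    moreover have "(\<Prod>k\<in>f ` J. prob (?B k)) = (\<Prod>j\<in>J. prob (A j))"
      by (subst prod.reindex[OF injJ]) (simp add: B[unfolded o_def] o_def)
    ultimately show "prob (\<Inter>j\<in>J. A j) = (\<Prod>j\<in>J. prob (A j))" by simp
  qed
  then show ?thesis using ind by (simp add: indep_vars_def2)
qed

text \<open>Independence factorises the moment generating function of the sum, and the exponents add
  up to that of variance \<open>v * (norm x)\<^sup>2\<close>. This is all the Chernoff bound asks
  for, so the law of the sum need not be identified. Measuring the threshold in standard deviations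
  makes the bound independent of \<open>v\<close> and \<open>x\<close>, which later allows a random
  \<open>x\<close>.\<close>

lemma (in prob_space) gaussian_linear_combination_tail:
  fixes X :: "'j::finite \<Rightarrow> 'a \<Rightarrow> real" and x :: "real ^ 'j"
  assumes ind: "indep_vars (\<lambda>_. borel) X UNIV"
    and gauss: "\<And>j. has_gaussian_law M (X j) 0 v" and v: "v \<ge> 0" and c: "c > 0"
  shows "prob {\<omega> \<in> space M. \<bar>\<Sum>j\<in>UNIV. X j \<omega> * x $ j\<bar> > sqrt v * c * norm x}
    \<le> 2 * exp (- c\<^sup>2 / 2)"
proof -
  have X[measurable]: "X j \<in> borel_measurable M" for j
    using gauss[of j] by (simp add: has_gaussian_law_def)
  show ?thesis
  proof (cases "v = 0 \<or> x = 0")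
    \<comment> \<open>In the degenerate case the sum vanishes almost surely and the threshold is 0.
      Since the event is a strict inequality, it is null.\<close>
    case True
    have "AE \<omega> in M. (\<Sum>j\<in>UNIV. X j \<omega> * x $ j) = 0"
    proof (cases "x = 0")
      case False
      with True have v0: "v = 0" by simp
      have "AE \<omega> in M. X j \<omega> = 0" for j
      proof -
        have D: "distr M borel (X j) = return borel 0"
          using gauss[of j] v0 by (simp add: has_gaussian_law_def gaussian_measure_def)
        have "AE y in distr M borel (X j). y = 0"
          unfolding D by (subst AE_return) auto
        then show ?thesis by (subst (asm) AE_distr_iff) auto
      qed
      then have "AE \<omega> in M. \<forall>j. X j \<omega> = 0" by (simp add: AE_all_countable)
      then show ?thesis by eventually_elim simp
    qed simp
    then have "prob {\<omega> \<in> space M. \<bar>\<Sum>j\<in>UNIV. X j \<omega> * x $ j\<bar> > sqrt v * c * norm x} = 0"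
      using True by (intro prob_eq_0[THEN iffD2]) auto
    then show ?thesis by simp
  next
    case False
    then have pos: "v > 0" "norm x > 0" using v by auto
    have ind': "indep_vars (\<lambda>_. borel) (\<lambda>j \<omega>. exp (l * x $ j * X j \<omega>)) UNIV" for l
      by (rule indep_vars_compose2[OF ind]) auto
    have prod: "exp (l * (\<Sum>j\<in>UNIV. X j \<omega> * x $ j)) = (\<Prod>j\<in>UNIV. exp (l * x $ j * X j \<omega>))"
      for l \<omega>
      by (simp add: exp_sum[symmetric] sum_distrib_left mult_ac)
    note mgf = gaussian_mgf[OF prob_space_axioms gauss v]
    have int: "integrable M (\<lambda>\<omega>. exp (l * (\<Sum>j\<in>UNIV. X j \<omega> * x $ j)))" for l
      unfolding prod by (intro indep_vars_integrable ind' mgf) auto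
    have val: "expectation (\<lambda>\<omega>. exp (l * (\<Sum>j\<in>UNIV. X j \<omega> * x $ j)))
        = exp (l\<^sup>2 * (v * (norm x)\<^sup>2) / 2)" for l
    proof -
      have "expectation (\<lambda>\<omega>. exp (l * (\<Sum>j\<in>UNIV. X j \<omega> * x $ j)))
          = (\<Prod>j\<in>UNIV. expectation (\<lambda>\<omega>. exp (l * x $ j * X j \<omega>)))"
        unfolding prod by (intro indep_vars_lebesgue_integral ind' mgf) auto
      also have "\<dots> = exp (\<Sum>j\<in>UNIV. (l * x $ j)\<^sup>2 * v / 2)"
        by (simp add: mgf exp_sum)
      also have "(\<Sum>j\<in>UNIV. (l * x $ j)\<^sup>2 * v / 2) = l\<^sup>2 * (v * (norm x)\<^sup>2) / 2"
        by (simp add: norm_vec_def L2_set_def sum_nonneg sum_distrib_left sum_divide_distrib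
            power_mult_distrib mult_ac)
      finally show ?thesis .
    qed
    have "prob {\<omega> \<in> space M. \<bar>\<Sum>j\<in>UNIV. X j \<omega> * x $ j\<bar> > sqrt v * c * norm x}
        \<le> 2 * exp (- (sqrt v * c * norm x)\<^sup>2 / (2 * (v * (norm x)\<^sup>2)))"
      using pos c by (intro subgaussian_tail int) (auto simp: val)
    also have "- (sqrt v * c * norm x)\<^sup>2 / (2 * (v * (norm x)\<^sup>2)) = - c\<^sup>2 / 2"
      using pos by (simp add: power_mult_distrib)
    finally show ?thesis by simp
  qed
qed

section \<open>Freezing an independent random variable\<close>

lemma (in prob_space) distr_pair_indep_rv:
  assumes "indep_rv M N X P Y"
  shows "distr M (N \<Otimes>\<^sub>M P) (\<lambda>\<omega>. (X \<omega>, Y \<omega>)) = distr M N X \<Otimes>\<^sub>M distr M P Y"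
proof -
  have X[measurable]: "X \<in> measurable M N" and Y[measurable]: "Y \<in> measurable M P"
    and ind: "indep_set (sets (vimage_algebra (space M) X N)) (sets (vimage_algebra (space M) Y P))"
    using assms by (auto simp: indep_rv_def)
  interpret X: prob_space "distr M N X" by (rule prob_space_distr) fact
  interpret Y: prob_space "distr M P Y" by (rule prob_space_distr) fact
  show ?thesis
  \<comment> \<open>A product of sigma-finite measures is determined by its values on rectangles,
    and on rectangles the claim is the product rule for independent events.\<close>
  proof (rule pair_measure_eqI[symmetric])
    fix A B assume "A \<in> sets (distr M N X)" "B \<in> sets (distr M P Y)"
    then have A[measurable]: "A \<in> sets N" and B[measurable]: "B \<in> sets P" by auto
    have "prob ((X -` A \<inter> space M) \<inter> (Y -` B \<inter> space M))
        = prob (X -` A \<inter> space M) * prob (Y -` B \<inter> space M)"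
      by (intro indep_setD[OF ind] in_vimage_algebra A B)
    moreover have "(\<lambda>\<omega>. (X \<omega>, Y \<omega>)) -` (A \<times> B) \<inter> space M
        = (X -` A \<inter> space M) \<inter> (Y -` B \<inter> space M)"
      by auto
    ultimately show "emeasure (distr M N X) A * emeasure (distr M P Y) B
        = emeasure (distr M (N \<Otimes>\<^sub>M P) (\<lambda>\<omega>. (X \<omega>, Y \<omega>))) (A \<times> B)"
      by (simp add: emeasure_distr emeasure_eq_measure ennreal_mult')
  qed (auto intro: X.sigma_finite_measure_axioms Y.sigma_finite_measure_axioms
      sets_pair_measure_cong)
qed

text \<open>Fubini: under independence the joint law is a product, so the probability is an average
  over \<open>y\<close> of the section probabilities, each at most \<open>b\<close>. A tail bound
  for deterministic vectors thus extends to vectors independent of the matrix.\<close>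

lemma (in prob_space) prob_le_of_sections:
  assumes ind: "indep_rv M N X P Y" and Q[measurable]: "Measurable.pred (N \<Otimes>\<^sub>M P) (case_prod Q)"
    and sec: "\<And>y. y \<in> space P \<Longrightarrow> prob {\<omega> \<in> space M. Q (X \<omega>) y} \<le> b"
  shows "prob {\<omega> \<in> space M. Q (X \<omega>) (Y \<omega>)} \<le> b"
proof -
  have X[measurable]: "X \<in> measurable M N" and Y[measurable]: "Y \<in> measurable M P"
    using ind by (auto simp: indep_rv_def)
  interpret X: prob_space "distr M N X" by (rule prob_space_distr) fact
  interpret Y: prob_space "distr M P Y" by (rule prob_space_distr) fact
  interpret XY: pair_prob_space "distr M N X" "distr M P Y" ..
  \<comment> \<open>\<open>P\<close> carries a probability law and so has a point; the section bound
    there forces \<open>b\<close> to be nonnegative, as the passage through \<open>ennreal b\<close>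
    requires.\<close>
  obtain y0 where "y0 \<in> space P" using Y.not_empty by auto
  then have b: "b \<ge> 0" using sec[of y0] measure_nonneg[of M] by (meson order_trans)
  define A where "A = {z \<in> space (N \<Otimes>\<^sub>M P). case_prod Q z}"
  have A[measurable]: "A \<in> sets (N \<Otimes>\<^sub>M P)" unfolding A_def by measurable
  have "emeasure M {\<omega> \<in> space M. Q (X \<omega>) (Y \<omega>)}
      = emeasure (distr M (N \<Otimes>\<^sub>M P) (\<lambda>\<omega>. (X \<omega>, Y \<omega>))) A"
    using measurable_space[OF X] measurable_space[OF Y]
    by (subst emeasure_distr)
      (auto simp: A_def space_pair_measure intro!: arg_cong[where f = "emeasure M"])
  also have "\<dots> = emeasure (distr M N X \<Otimes>\<^sub>M distr M P Y) A"
    by (simp add: distr_pair_indep_rv[OF ind])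
  also have "\<dots> = (\<integral>\<^sup>+ y. emeasure (distr M N X) ((\<lambda>x. (x, y)) -` A) \<partial>distr M P Y)"
    by (rule XY.emeasure_pair_measure_alt2) (simp cong: sets_pair_measure_cong)
  also have "\<dots> \<le> (\<integral>\<^sup>+ y. ennreal b \<partial>distr M P Y)"
  proof (rule nn_integral_mono)
    fix y assume "y \<in> space (distr M P Y)"
    then have y: "y \<in> space P" by simp
    have "(\<lambda>x. (x, y)) -` A \<in> sets N" by (rule sets_Pair2[OF A])
    then have "emeasure (distr M N X) ((\<lambda>x. (x, y)) -` A)
        = emeasure M (X -` ((\<lambda>x. (x, y)) -` A) \<inter> space M)"
      by (rule emeasure_distr[OF X])
    also have "X -` ((\<lambda>x. (x, y)) -` A) \<inter> space M = {\<omega> \<in> space M. Q (X \<omega>) y}"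
      using y measurable_space[OF X] by (auto simp: A_def space_pair_measure)
    finally show "emeasure (distr M N X) ((\<lambda>x. (x, y)) -` A) \<le> ennreal b"
      using sec[OF y] by (simp add: emeasure_eq_measure ennreal_leI)
  qed
  also have "\<dots> = ennreal b" using Y.emeasure_space_1 by simp
  finally show ?thesis using b by (simp add: emeasure_eq_measure)
qed

section \<open>The maximum norm of a Gaussian matrix applied to a vector\<close>

lemma infnorm_le_iff_cart: "infnorm (x :: real ^ 'n) \<le> b \<longleftrightarrow> (\<forall>i. \<bar>x $ i\<bar> \<le> b)"
proof
  assume "\<forall>i. \<bar>x $ i\<bar> \<le> b"
  then show "infnorm x \<le> b" unfolding infnorm_cart by (intro cSup_least) auto
qed (use component_le_infnorm_cart order_trans in blast)

lemma borel_measurable_infnorm [measurable]: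
  "infnorm \<in> borel_measurable (borel :: 'a::euclidean_space measure)"
  by (intro borel_measurable_continuous_onI continuous_on_infnorm continuous_on_id)

lemma borel_measurable_matrix_vector_mult [measurable (raw)]:
  fixes f :: "'a \<Rightarrow> real ^ 'm ^ 'n"
  assumes "f \<in> borel_measurable M" "h \<in> borel_measurable M"
  shows "(\<lambda>x. f x *v h x) \<in> borel_measurable M"
proof -
  have "continuous_on UNIV (\<lambda>z :: (real ^ 'm ^ 'n) \<times> (real ^ 'm). fst z *v snd z)"
    unfolding matrix_vector_mult_def by (intro continuous_intros)
  from borel_measurable_continuous_on[OF this borel_measurable_Pair[OF assms]]
  show ?thesis by simp
qed

text \<open>The maximum norm exceeds a level exactly when some coordinate does. Each coordinate is a
  linear combination of one row of independent Gaussians, and a union bound over the rows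
  contributes the factor \<open>CARD('n)\<close>.\<close>

lemma (in prob_space) gaussian_matrix_infnorm_tail:
  fixes R :: "'a \<Rightarrow> real ^ 'm ^ 'n" and x :: "real ^ 'm"
  assumes R[measurable]: "R \<in> borel_measurable M"
    and ind: "indep_vars (\<lambda>_. borel) (\<lambda>(i, j) \<omega>. R \<omega> $ i $ j) (UNIV :: ('n \<times> 'm) set)"
    and gauss: "\<And>i j. has_gaussian_law M (\<lambda>\<omega>. R \<omega> $ i $ j) 0 v" and v: "v \<ge> 0" and c: "c > 0"
  shows "prob {\<omega> \<in> space M. infnorm (R \<omega> *v x) > sqrt v * c * norm x}
    \<le> 2 * real CARD('n) * exp (- c\<^sup>2 / 2)"
proof -
  let ?E = "\<lambda>i. {\<omega> \<in> space M. \<bar>\<Sum>j\<in>UNIV. R \<omega> $ i $ j * x $ j\<bar> > sqrt v * c * norm x}"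
  have R'[measurable]: "(\<lambda>\<omega>. R \<omega> $ i $ j) \<in> borel_measurable M" for i j
    using gauss[of i j] by (simp add: has_gaussian_law_def)
  have row: "indep_vars (\<lambda>_. borel) (\<lambda>j \<omega>. R \<omega> $ i $ j) (UNIV :: 'm set)" for i
    \<comment> \<open>Row \<open>i\<close> is the subfamily of entries over the range of the
      injective map \<open>Pair i\<close>, reindexed by the column alone.\<close>
    using indep_vars_reindex[OF indep_vars_subset[OF ind, of "range (Pair i)"]]
    by (simp add: inj_on_def)
  have "{\<omega> \<in> space M. infnorm (R \<omega> *v x) > sqrt v * c * norm x} = (\<Union>i. ?E i)"
    by (auto simp: not_le[symmetric] infnorm_le_iff_cart matrix_vector_mult_def)
  then have "prob {\<omega> \<in> space M. infnorm (R \<omega> *v x) > sqrt v * c * norm x} \<le> (\<Sum>i\<in>UNIV. prob (?E i))"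
    by (simp only:) (intro finite_measure_subadditive_finite; auto)
  also have "\<dots> \<le> (\<Sum>i\<in>(UNIV :: 'n set). 2 * exp (- c\<^sup>2 / 2))"
    by (intro sum_mono gaussian_linear_combination_tail row gauss v c)
  finally show ?thesis by simp
qed

section \<open>The high-probability bound on the data-path budget\<close>

theorem corollary5p11:
  fixes M :: "'w measure"
    and R :: "'w \<Rightarrow> real ^ 'm ^ 'n"
    and S :: "'w \<Rightarrow> real ^ 'm ^ 'n"
    and \<psi>\<^sub>1 :: "'w \<Rightarrow> 's \<Rightarrow> real ^ 'm"
    and \<psi>\<^sub>2 :: "'w \<Rightarrow> real ^ 'n \<Rightarrow> real ^ 'k"
    and L :: "'s \<Rightarrow> 'w \<Rightarrow> real"
    and W :: "'w \<Rightarrow> 'c"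
    and N :: "'c measure"
    and T :: "'s set"
    and g \<delta> :: real
  assumes "prob_space M"
    and "finite T" and "T \<noteq> {}"
    and "g \<ge> 0"
    and R_entries_indep:
      "prob_space.indep_vars M (\<lambda>_. borel) (\<lambda>(i, j) \<omega>. R \<omega> $ i $ j) (UNIV :: ('n \<times> 'm) set)"
    and R_entries_normal:
      "\<And>i j. has_gaussian_law M (\<lambda>\<omega>. R \<omega> $ i $ j) 0 (g / real CARD('n))"
    and R_indep_v:
      "indep_rv M borel R (Pi\<^sub>M T (\<lambda>_. borel)) (\<lambda>\<omega>. restrict (\<psi>\<^sub>1 \<omega>) T)"
    and R_indep_W: "indep_rv M borel R N W"
    and L_measurable:
      "\<And>s. s \<in> T \<Longrightarrow> L s \<in> borel_measurable (vimage_algebra (space M) W N)"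
    and L_nonneg: "\<And>s. s \<in> T \<Longrightarrow> AE \<omega> in M. 0 \<le> L s \<omega>"
    and L_lipschitz:
      "\<And>s. s \<in> T \<Longrightarrow> AE \<omega> in M.
         linf_lipschitz_on (L s \<omega>) (layer_path (S \<omega>) (R \<omega>) (\<psi>\<^sub>1 \<omega> s)) (\<psi>\<^sub>2 \<omega>)"
    and "0 < \<delta>" and "\<delta> < 1"
  shows "measure M {\<omega> \<in> space M.
            data_path_budget T (\<lambda>s. L s \<omega>) (\<psi>\<^sub>1 \<omega>) (R \<omega>)
            \<le> 2 * mp_edge g CARD('n) CARD('m) / (1 + sqrt (real CARD('m) / real CARD('n)))
              * sqrt (2 / real CARD('n) * ln (2 * real CARD('n) * real (card T) / \<delta>))
              * (1 / real (card T) * (\<Sum>s\<in>T. L s \<omega> * norm (\<psi>\<^sub>1 \<omega> s)))}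
         \<ge> 1 - \<delta>"
proof -
  interpret prob_space M by fact
  let ?n = "real CARD('n)" and ?m = "real CARD('m)" and ?t = "real (card T)"
  \<comment> \<open>\<open>c\<close> solves
    \<open>2 * ?n * exp (- c\<^sup>2 / 2) = \<delta> / ?t\<close>, so each data point receives an
    equal share of the failure probability. \<open>b\<close> is the resulting threshold per unit of
    \<open>norm (\<psi>\<^sub>1 \<omega> s)\<close>, with entry standard deviation
    \<open>sqrt (g / ?n)\<close>.\<close>
  define c where "c = sqrt (2 * ln (2 * ?n * ?t / \<delta>))"
  define b where "b = sqrt (g / ?n) * c"
  have n: "?n \<ge> 1" and t: "?t \<ge> 1"
    using assms(2,3) by (auto simp: Suc_le_eq card_gt_0_iff)
  \<comment> \<open>Both cardinalities are at least 1 and \<open>\<delta> < 1\<close>, so the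
    logarithm is positive and hence so is \<open>c\<close>, as the tail bound demands.\<close>
  have "1 * 1 \<le> ?n * ?t" using n t by (intro mult_mono) auto
  then have arg: "2 * ?n * ?t / \<delta> > 1" using assms(12,13) by (simp add: field_simps)
  then have c: "c > 0" and c2: "c\<^sup>2 = 2 * ln (2 * ?n * ?t / \<delta>)"
    by (auto simp: c_def ln_gt_zero)
  have tail: "2 * ?n * exp (- c\<^sup>2 / 2) = \<delta> / ?t"
    using arg n t assms(12) by (simp add: c2 exp_minus field_simps)
  have R[measurable]: "R \<in> borel_measurable M"
    and v: "(\<lambda>\<omega>. restrict (\<psi>\<^sub>1 \<omega>) T) \<in> measurable M (Pi\<^sub>M T (\<lambda>_. borel))"
    and W: "W \<in> measurable M N"
    using R_indep_v R_indep_W by (auto simp: indep_rv_def)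
  have v_s: "(\<lambda>\<omega>. \<psi>\<^sub>1 \<omega> s) \<in> borel_measurable M" if "s \<in> T" for s
    using measurable_compose[OF v measurable_component_singleton[OF that]] that by simp
  have norm_meas: "(\<lambda>\<omega>. norm (\<psi>\<^sub>1 \<omega> s)) \<in> borel_measurable M"
    and infnorm_meas: "(\<lambda>\<omega>. infnorm (R \<omega> *v \<psi>\<^sub>1 \<omega> s)) \<in> borel_measurable M" if "s \<in> T" for s
    using v_s[OF that] by measurable
  have L: "L s \<in> borel_measurable M" if "s \<in> T" for s
  proof -
    \<comment> \<open>The sigma-algebra generated by \<open>W\<close> lies inside that of
      \<open>M\<close>, so each \<open>L s\<close> is a random variable on \<open>M\<close>.\<close>
    have "sets (vimage_algebra (space M) W N) \<subseteq> sets M"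
      using W by (auto simp: sets_vimage_algebra2 measurable_def)
    then show ?thesis using L_measurable[OF that] by (auto simp: measurable_def)
  qed
  let ?bad = "\<lambda>s. {\<omega> \<in> space M. infnorm (R \<omega> *v \<psi>\<^sub>1 \<omega> s) > b * norm (\<psi>\<^sub>1 \<omega> s)}"
  let ?good = "{\<omega> \<in> space M. data_path_budget T (\<lambda>s. L s \<omega>) (\<psi>\<^sub>1 \<omega>) (R \<omega>)
            \<le> 2 * mp_edge g CARD('n) CARD('m) / (1 + sqrt (?m / ?n))
              * sqrt (2 / ?n * ln (2 * ?n * ?t / \<delta>))
              * (1 / ?t * (\<Sum>s\<in>T. L s \<omega> * norm (\<psi>\<^sub>1 \<omega> s)))}"
  have bad_meas: "?bad s \<in> events" if "s \<in> T" for s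
    using that by (intro borel_measurable_less borel_measurable_times borel_measurable_const
        norm_meas infnorm_meas)
  have bad_prob: "prob (?bad s) \<le> \<delta> / ?t" if s: "s \<in> T" for s
  proof -
    have [measurable]: "(\<lambda>y. y s) \<in> borel_measurable (Pi\<^sub>M T (\<lambda>_. borel :: (real ^ 'm) measure))"
      by (rule measurable_component_singleton[OF s])
    \<comment> \<open>Independence is given for the whole restricted family; the predicate reads
      only its component \<open>s\<close>, where restriction changes nothing because
      \<open>s \<in> T\<close>.\<close>
    have "prob {\<omega> \<in> space M. infnorm (R \<omega> *v restrict (\<psi>\<^sub>1 \<omega>) T s) > b * norm (restrict (\<psi>\<^sub>1 \<omega>) T s)}
        \<le> 2 * ?n * exp (- c\<^sup>2 / 2)"
      unfolding b_def using assms(4) c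
      by (intro prob_le_of_sections[OF R_indep_v,
            where Q = "\<lambda>A y. infnorm (A *v y s) > sqrt (g / ?n) * c * norm (y s)"]
          gaussian_matrix_infnorm_tail[OF R R_entries_indep R_entries_normal]) auto
    then show ?thesis using s tail by simp
  qed
  have "prob (\<Union>s\<in>T. ?bad s) \<le> (\<Sum>s\<in>T. prob (?bad s))"
    using assms(2) by (intro finite_measure_subadditive_finite image_subsetI bad_meas)
  also have "\<dots> \<le> (\<Sum>s\<in>T. \<delta> / ?t)" by (intro sum_mono bad_prob)
  also have "\<dots> = \<delta>" using t by simp
  finally have bad: "prob (\<Union>s\<in>T. ?bad s) \<le> \<delta>" .
  \<comment> \<open>The aspect-ratio factor of the edge cancels against the denominator, leaving
    only the entry scale \<open>sqrt g\<close>.\<close>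
  have edge: "2 * mp_edge g CARD('n) CARD('m) / (1 + sqrt (?m / ?n)) = 2 * sqrt g"
  proof -
    have "1 + sqrt (?m / ?n) > 0" by (intro add_pos_nonneg) auto
    then show ?thesis by (simp add: mp_edge_def)
  qed
  have b_alt: "b = sqrt g * sqrt (2 / ?n * ln (2 * ?n * ?t / \<delta>))"
    unfolding b_def c_def real_sqrt_mult[symmetric] by (simp add: mult_ac)
  have b_eq: "2 * mp_edge g CARD('n) CARD('m) / (1 + sqrt (?m / ?n))
      * sqrt (2 / ?n * ln (2 * ?n * ?t / \<delta>)) = 2 * b"
    by (simp only: edge b_alt mult.assoc)
  \<comment> \<open>Measurability of the target event is what permits comparing probabilities
    through an almost sure inclusion.\<close>
  have good_meas: "?good \<in> events"
    unfolding data_path_budget_def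
    by (intro borel_measurable_le borel_measurable_times borel_measurable_const
        borel_measurable_sum L norm_meas infnorm_meas)
  \<comment> \<open>Nonnegativity of the weights holds only almost surely; finiteness of
    \<open>T\<close> merges the exceptional null sets into one. Off it, multiplying the coordinate
    bounds by \<open>L s \<omega>\<close> preserves them.\<close>
  have "AE \<omega> in M. \<forall>s\<in>T. 0 \<le> L s \<omega>"
    using L_nonneg assms(2) by (simp add: AE_finite_all)
  then have "AE \<omega> in M. \<omega> \<in> space M - (\<Union>s\<in>T. ?bad s) \<longrightarrow> \<omega> \<in> ?good"
  proof eventually_elim
    case (elim \<omega>)
    show ?case
    proof
      assume \<omega>: "\<omega> \<in> space M - (\<Union>s\<in>T. ?bad s)"
      have "(\<Sum>s\<in>T. L s \<omega> * infnorm (R \<omega> *v \<psi>\<^sub>1 \<omega> s)) \<le> (\<Sum>s\<in>T. L s \<omega> * (b * norm (\<psi>\<^sub>1 \<omega> s)))"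
        using elim \<omega> by (intro sum_mono mult_left_mono) (auto simp: not_less)
      also have "\<dots> = b * (\<Sum>s\<in>T. L s \<omega> * norm (\<psi>\<^sub>1 \<omega> s))"
        by (simp add: sum_distrib_left mult_ac)
      finally have "2 / ?t * (\<Sum>s\<in>T. L s \<omega> * infnorm (R \<omega> *v \<psi>\<^sub>1 \<omega> s))
          \<le> 2 / ?t * (b * (\<Sum>s\<in>T. L s \<omega> * norm (\<psi>\<^sub>1 \<omega> s)))"
        by (intro mult_left_mono) auto
      then show "\<omega> \<in> ?good"
        using \<omega> unfolding b_eq data_path_budget_def by simp
    qed
  qed
  then have "prob (space M - (\<Union>s\<in>T. ?bad s)) \<le> prob ?good"
    using good_meas by (rule finite_measure_mono_AE)
  moreover have "prob (space M - (\<Union>s\<in>T. ?bad s)) = 1 - prob (\<Union>s\<in>T. ?bad s)"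
    using assms(2) bad_meas by (intro prob_compl sets.finite_UN)
  ultimately show ?thesis using bad by simp
qed

end
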